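(* Let $G$ be a weighted signed block graph. If every triangle (cycle of length $3$) in $G$ is balanced, then $\det A(G)=\det A(|G|)$.
   Context: A weighted signed graph is a simple undirected graph whose edges carry arbitrary nonzero real weights (positive or negative); its adjacency matrix $A(G)=(a_{ij})$ has $a_{ij}$ equal to the weight of the edge $\{i,j\}$ and $a_{ij}=0$ if $i,j$ are non-adjacent (including $i=j$). $|G|$ is the underlying graph obtained by replacing every edge weight by its absolute value (negative edges become positive). A cycle is balanced if the product of the weights of its edges is positive. A block of a graph is a maximal connected subgraph without a cut-vertex; a (weighted signed) block graph is a graph every block of which is a complete graph (with arbitrary weights on its edges). The determinant of a graph means the determinant of its adjacency matrix. *)

theory Defs
  imports "HOL-Analysis.Determinants"
begin

record 'v graph =
  verts :: "'v set"
  edges :: "'v set set"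

definition simple_graph :: "('v, 'b) graph_scheme \<Rightarrow> bool" where
  "simple_graph G \<longleftrightarrow> (\<forall>e\<in>edges G. e \<subseteq> verts G \<and> card e = 2)"

definition subgraph :: "'v graph \<Rightarrow> ('v, 'b) graph_scheme \<Rightarrow> bool" where
  "subgraph H G \<longleftrightarrow> simple_graph H \<and> verts H \<subseteq> verts G \<and> edges H \<subseteq> edges G"

definition reachable :: "('v, 'b) graph_scheme \<Rightarrow> 'v \<Rightarrow> 'v \<Rightarrow> bool" where
  "reachable G = (\<lambda>u v. {u, v} \<in> edges G)\<^sup>*\<^sup>*"

definition connected_graph :: "('v, 'b) graph_scheme \<Rightarrow> bool" where
  "connected_graph G \<longleftrightarrow> verts G \<noteq> {} \<and> (\<forall>u\<in>verts G. \<forall>v\<in>verts G. reachable G u v)"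

definition delete_vertex :: "('v, 'b) graph_scheme \<Rightarrow> 'v \<Rightarrow> 'v graph" where
  "delete_vertex G x = \<lparr>verts = verts G - {x}, edges = {e \<in> edges G. x \<notin> e}\<rparr>"

definition cut_vertex :: "('v, 'b) graph_scheme \<Rightarrow> 'v \<Rightarrow> bool" where
  "cut_vertex G x \<longleftrightarrow> x \<in> verts G \<and>
     (\<exists>u\<in>verts G - {x}. \<exists>v\<in>verts G - {x}.
        reachable G u v \<and> \<not> reachable (delete_vertex G x) u v)"

definition nonseparable :: "('v, 'b) graph_scheme \<Rightarrow> bool" where
  "nonseparable G \<longleftrightarrow> connected_graph G \<and> (\<nexists>x. cut_vertex G x)"

definition block_of :: "'v graph \<Rightarrow> ('v, 'b) graph_scheme \<Rightarrow> bool" where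
  "block_of B G \<longleftrightarrow> subgraph B G \<and> nonseparable B \<and>
     (\<forall>H. subgraph H G \<and> nonseparable H \<and> subgraph B H \<longrightarrow> H = B)"

definition complete_graph :: "('v, 'b) graph_scheme \<Rightarrow> bool" where
  "complete_graph G \<longleftrightarrow> edges G = {e. e \<subseteq> verts G \<and> card e = 2}"

definition block_graph :: "('v, 'b) graph_scheme \<Rightarrow> bool" where
  "block_graph G \<longleftrightarrow> (\<forall>B. block_of B G \<longrightarrow> complete_graph B)"

record 'v weighted_graph = "'v graph" +
  weight :: "'v set \<Rightarrow> real"

definition weighted_signed_graph :: "'v weighted_graph \<Rightarrow> bool" where
  "weighted_signed_graph G \<longleftrightarrow>
     finite (verts G) \<and> simple_graph G \<and> (\<forall>e\<in>edges G. weight G e \<noteq> 0)"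

definition abs_graph :: "'v weighted_graph \<Rightarrow> 'v weighted_graph" where
  "abs_graph G = G\<lparr>weight := \<lambda>e. \<bar>weight G e\<bar>\<rparr>"

text \<open>The rows and columns are indexed by the whole type, so this is the adjacency
  matrix of \<open>G\<close> only when \<open>verts G = UNIV\<close>. The diagonal of a simple graph vanishes
  because the singleton \<open>{i, i}\<close> is not an edge.\<close>

definition adjacency_matrix :: "'v::finite weighted_graph \<Rightarrow> real^'v^'v" where
  "adjacency_matrix G = (\<chi> i j. if {i, j} \<in> edges G then weight G {i, j} else 0)"

text \<open>A cycle is given by the list of its vertices in cyclic order, without repeating
  the first one at the end.\<close>

definition cycle_edge :: "'v list \<Rightarrow> nat \<Rightarrow> 'v set" where
  "cycle_edge vs i = {vs ! i, vs ! (Suc i mod length vs)}"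

definition is_cycle :: "('v, 'b) graph_scheme \<Rightarrow> 'v list \<Rightarrow> bool" where
  "is_cycle G vs \<longleftrightarrow> 3 \<le> length vs \<and> distinct vs \<and> set vs \<subseteq> verts G \<and>
     (\<forall>i<length vs. cycle_edge vs i \<in> edges G)"

definition balanced_cycle :: "'v weighted_graph \<Rightarrow> 'v list \<Rightarrow> bool" where
  "balanced_cycle G vs \<longleftrightarrow> 0 < (\<Prod>i<length vs. weight G (cycle_edge vs i))"

end

theory Submission
  imports Defs
begin

text \<open>The vertex set of a cycle induces a nonseparable subgraph, which lies in a block and is
  therefore a clique, so every cycle of length at least four has a chord. Cutting along repeated
  vertices and chords reduces every closed walk to triangles and backtracked edges, hence the
  product of the weights along any closed walk is positive. Thus the sign of a walk depends only
  on its ends, which yields signs \<open>s\<close> with \<open>a\<^sub>i\<^sub>j = s\<^sub>i \<bar>a\<^sub>i\<^sub>j\<bar> s\<^sub>j\<close>; conjugation by the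
  diagonal matrix of \<open>s\<close> does not change the determinant.\<close>

abbreviation walk :: "('v, 'b) graph_scheme \<Rightarrow> 'v list \<Rightarrow> bool" where
  "walk G \<equiv> successively (\<lambda>u v. {u, v} \<in> edges G)"

section \<open>Blocks and chords of cycles\<close>

lemma reachable_refl: "reachable G u u"
  by (simp add: reachable_def)

lemma reachable_trans: "reachable G u v \<Longrightarrow> reachable G v w \<Longrightarrow> reachable G u w"
  by (simp add: reachable_def)

lemma reachable_edge: "{u, v} \<in> edges G \<Longrightarrow> reachable G u v"
  by (simp add: reachable_def r_into_rtranclp)

lemma reachable_sym:
  assumes "reachable G u v" shows "reachable G v u"
proof -
  have "symp (\<lambda>u v. {u, v} \<in> edges G)\<^sup>*\<^sup>*"
    by (rule symp_rtranclp) (simp add: symp_def insert_commute)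
  then show ?thesis using assms by (auto simp: reachable_def symp_def)
qed

lemma walk_reachable_hd: "walk G xs \<Longrightarrow> v \<in> set xs \<Longrightarrow> reachable G (hd xs) v"
proof (induction xs)
  case (Cons x xs)
  then show ?case
    by (cases xs) (auto intro: reachable_refl reachable_trans[OF reachable_edge])
qed simp

lemma walk_reachable:
  assumes "walk G xs" "u \<in> set xs" "v \<in> set xs"
  shows "reachable G u v"
  by (rule reachable_trans[OF reachable_sym]) (use assms in \<open>auto intro: walk_reachable_hd\<close>)

lemma reachable_imp_walk:
  assumes "reachable G u v"
  obtains xs where "xs \<noteq> []" "hd xs = u" "last xs = v" "walk G xs"
proof -
  from assms have "\<exists>xs. xs \<noteq> [] \<and> hd xs = u \<and> last xs = v \<and> walk G xs"
    unfolding reachable_def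
  proof (induction rule: rtranclp_induct)
    case base
    show ?case by (rule exI[of _ "[u]"]) simp
  next
    case (step y z)
    then obtain xs where "xs \<noteq> []" "hd xs = u" "last xs = y" "walk G xs" by blast
    with step.hyps show ?case
      by (intro exI[of _ "xs @ [z]"]) (auto simp: successively_append_iff)
  qed
  then show thesis using that by blast
qed

definition induced_subgraph :: "('v, 'b) graph_scheme \<Rightarrow> 'v set \<Rightarrow> 'v graph" where
  "induced_subgraph G S = \<lparr>verts = S, edges = {e \<in> edges G. e \<subseteq> S}\<rparr>"

lemma subgraph_induced_subgraph:
  "simple_graph G \<Longrightarrow> S \<subseteq> verts G \<Longrightarrow> subgraph (induced_subgraph G S) G"
  by (auto simp: subgraph_def simple_graph_def induced_subgraph_def)

lemma walk_mono_on:
  assumes "walk G xs" "\<And>u v. u \<in> set xs \<Longrightarrow> v \<in> set xs \<Longrightarrow> {u, v} \<in> edges G \<Longrightarrow> {u, v} \<in> edges H"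
  shows "walk H xs"
  using assms by (rule successively_mono)

text \<open>Connectedness, before and after the deletion of a vertex, comes from a path through all
  remaining vertices. Chords kept by the induced subgraph can only add connections.\<close>

lemma nonseparable_induced_cycle:
  assumes walk: "walk G vs" and ne: "vs \<noteq> []" and dist: "distinct vs"
    and closing: "{last vs, hd vs} \<in> edges G"
  shows "nonseparable (induced_subgraph G (set vs))" (is "nonseparable ?H")
proof -
  have "walk ?H vs"
    using walk by (rule walk_mono_on) (auto simp: induced_subgraph_def)
  then have "connected_graph ?H"
    using ne walk_reachable[of ?H vs] by (auto simp: connected_graph_def induced_subgraph_def)
  moreover have "\<not> cut_vertex ?H x" for x
  proof (cases "x \<in> set vs")
    case True
    then obtain as bs where vs: "vs = as @ x # bs" by (meson split_list)
    \<comment> \<open>Opening the cycle at \<open>x\<close> leaves the path \<open>bs @ as\<close>.\<close>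
    have "walk G (bs @ as)"
      using walk closing by (auto simp: vs successively_append_iff successively_Cons hd_append
          split: if_splits)
    then have "walk (delete_vertex ?H x) (bs @ as)"
      by (rule walk_mono_on) (use dist in \<open>auto simp: induced_subgraph_def delete_vertex_def vs\<close>)
    from walk_reachable[OF this] show ?thesis
      by (auto simp: cut_vertex_def induced_subgraph_def vs)
  qed (simp add: cut_vertex_def induced_subgraph_def)
  ultimately show ?thesis by (simp add: nonseparable_def)
qed

lemma subgraph_refl: "simple_graph H \<Longrightarrow> subgraph H H"
  by (simp add: subgraph_def)

lemma subgraph_trans: "subgraph H K \<Longrightarrow> subgraph K G \<Longrightarrow> subgraph H G"
  by (auto simp: subgraph_def)

text \<open>Among the nonseparable subgraphs above \<open>H\<close>, one with the most vertices and
  edges together is maximal: a larger one in the sense of \<open>block_of\<close> has the same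
  counts, hence the same finite sets.\<close>

lemma ex_block_containing:
  assumes fin: "finite (verts G)" and simple: "simple_graph G"
    and H: "subgraph H G" "nonseparable H"
  obtains B where "block_of B G" "subgraph H B"
proof -
  have finE: "finite (edges G)"
    by (rule finite_subset[of _ "Pow (verts G)"]) (use fin simple in \<open>auto simp: simple_graph_def\<close>)
  define P where "P K \<longleftrightarrow> subgraph K G \<and> nonseparable K \<and> subgraph H K" for K :: "'a graph"
  define size where "size K = card (verts K) + card (edges K)" for K :: "'a graph"
  have "P H" using H subgraph_refl by (auto simp: P_def subgraph_def)
  \<comment> \<open>\<open>ex_has_greatest_nat\<close> asks for a strict upper bound, hence the
    \<open>Suc\<close>.\<close>
  moreover have "\<forall>K. P K \<longrightarrow> size K < Suc (card (verts G) + card (edges G))"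
    by (auto simp: P_def size_def subgraph_def less_Suc_eq_le intro!: add_mono card_mono fin finE)
  ultimately have "\<exists>B. P B \<and> (\<forall>K. P K \<longrightarrow> size K \<le> size B)"
    by (rule ex_has_greatest_nat)
  then obtain B where B: "P B" and max: "\<And>K. P K \<Longrightarrow> size K \<le> size B" by metis
  have "K = B" if K: "subgraph K G" "nonseparable K" "subgraph B K" for K
  proof -
    have sub: "verts B \<subseteq> verts K" "edges B \<subseteq> edges K" using K by (auto simp: subgraph_def)
    have fins: "finite (verts K)" "finite (edges K)"
      using K fin finE by (auto simp: subgraph_def intro: finite_subset)
    have "P K" using K B subgraph_trans by (auto simp: P_def)
    from max[OF this] have "size K \<le> size B" .
    moreover have "card (verts B) \<le> card (verts K)" "card (edges B) \<le> card (edges K)"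
      using sub fins by (auto intro: card_mono)
    ultimately have "card (verts B) = card (verts K)" "card (edges B) = card (edges K)"
      by (auto simp: size_def)
    then have "verts B = verts K" "edges B = edges K"
      using sub fins by (simp_all add: card_subset_eq)
    then show ?thesis by simp
  qed
  then have "block_of B G" using B by (auto simp: P_def block_of_def)
  then show thesis using that B by (simp add: P_def)
qed

text \<open>The subgraph induced by a cycle lies in a single block, and that block is
  complete.\<close>

lemma block_graph_cycle_clique:
  assumes "finite (verts G)" "simple_graph G" "block_graph G"
    and "walk G vs" "distinct vs" "set vs \<subseteq> verts G" "{last vs, hd vs} \<in> edges G"
    and uv: "u \<in> set vs" "v \<in> set vs" "u \<noteq> v"
  shows "{u, v} \<in> edges G"
proof -
  have "vs \<noteq> []" using uv by auto
  then obtain B where B: "block_of B G" "subgraph (induced_subgraph G (set vs)) B"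
    using assms ex_block_containing subgraph_induced_subgraph nonseparable_induced_cycle by metis
  then have "complete_graph B" using \<open>block_graph G\<close> by (simp add: block_graph_def)
  moreover have "{u, v} \<subseteq> verts B"
    using B(2) uv by (auto simp: subgraph_def induced_subgraph_def)
  ultimately have "{u, v} \<in> edges B" using uv by (auto simp: complete_graph_def)
  then show ?thesis using B(1) by (auto simp: block_of_def subgraph_def)
qed

section \<open>Signs of closed walks\<close>

fun walk_weight :: "('v set \<Rightarrow> 'a::comm_monoid_mult) \<Rightarrow> 'v list \<Rightarrow> 'a" where
  "walk_weight w (x # y # zs) = w {x, y} * walk_weight w (y # zs)"
| "walk_weight w _ = 1"

lemma walk_weight_append:
  "xs \<noteq> [] \<Longrightarrow> ys \<noteq> [] \<Longrightarrow>
    walk_weight w (xs @ ys) = walk_weight w xs * w {last xs, hd ys} * walk_weight w ys"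
proof (induction w xs rule: walk_weight.induct)
  case ("2_2" w v)
  then show ?case by (cases ys) auto
qed (auto simp: mult_ac)

text \<open>Serves to cut a walk at a visited vertex: \<open>z\<close> ends one part and starts the
  other, so each edge is counted exactly once.\<close>

lemma walk_weight_join:
  "walk_weight w (xs @ z # ys) = walk_weight w (xs @ [z]) * walk_weight w (z # ys)"
  by (cases "xs = []") (auto simp: walk_weight_append)

lemma walk_weight_rev: "walk_weight w (rev xs) = walk_weight w xs"
proof (induction w xs rule: walk_weight.induct)
  case (1 w x y zs)
  have "walk_weight w (rev (x # y # zs)) = walk_weight w (rev (y # zs)) * w {y, x}"
    using walk_weight_append[of "rev (y # zs)" "[x]" w] by simp
  then show ?case using 1 by (simp add: insert_commute mult.commute)
qed auto

lemma walk_rev: "walk G (rev xs) \<longleftrightarrow> walk G xs"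
  by (simp add: insert_commute)

lemma walk_weight_nonzero:
  fixes w :: "'v set \<Rightarrow> real"
  shows "walk G xs \<Longrightarrow> (\<And>e. e \<in> edges G \<Longrightarrow> w e \<noteq> 0) \<Longrightarrow> walk_weight w xs \<noteq> 0"
  by (induction w xs rule: walk_weight.induct) auto

text \<open>Strong induction on the length. Block graphs enter only through \<open>chord\<close>, so
  the argument is purely about lists.\<close>

lemma closed_walk_weight_pos:
  fixes w :: "'v set \<Rightarrow> real"
  assumes loopless: "\<And>u. {u, u} \<notin> edges G"
    and nonzero: "\<And>e. e \<in> edges G \<Longrightarrow> w e \<noteq> 0"
    and triangle: "\<And>a b c. walk G [a, b, c, a] \<Longrightarrow> walk_weight w [a, b, c, a] > 0"
    and chord: "\<And>vs u v. walk G vs \<Longrightarrow> distinct vs \<Longrightarrow> {last vs, hd vs} \<in> edges G \<Longrightarrow>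
      u \<in> set vs \<Longrightarrow> v \<in> set vs \<Longrightarrow> u \<noteq> v \<Longrightarrow> {u, v} \<in> edges G"
  shows "walk G xs \<Longrightarrow> xs \<noteq> [] \<Longrightarrow> hd xs = last xs \<Longrightarrow> walk_weight w xs > 0"
proof (induction xs rule: length_induct)
  case (1 xs)
  have IH: "walk_weight w ys > 0"
    if "length ys < length xs" "walk G ys" "ys \<noteq> []" "hd ys = last ys" for ys
    using 1(1) that by blast
  obtain a ys where xs: "xs = a # ys" using \<open>xs \<noteq> []\<close> by (cases xs) auto
  show ?case
  proof (cases "ys = []")
    case True
    then show ?thesis by (simp add: xs)
  next
    case ys: False
    have last: "last ys = a" and walk: "walk G (a # ys)" using 1(2,4) xs ys by auto
    show ?thesis
    \<comment> \<open>The start \<open>a\<close> recurs as the last entry of \<open>ys\<close>, so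
      repetitions are looked for in the tail only; if there are none, \<open>ys\<close> lists each
      visited vertex once.\<close>
    proof (cases "distinct ys")
      case False
      then obtain as z bs cs where ys_eq: "ys = as @ [z] @ bs @ [z] @ cs"
        using not_distinct_decomp by blast
      \<comment> \<open>The detour between the two visits of \<open>z\<close> and the walk that
        skips it are both closed and shorter than \<open>xs\<close>.\<close>
      have "walk_weight w (z # bs @ [z]) > 0"
        by (rule IH) (use walk in \<open>auto simp: xs ys_eq successively_append_iff successively_Cons
            hd_append split: if_splits\<close>)
      moreover have "walk_weight w ((a # as) @ z # cs) > 0"
        by (rule IH) (use walk last in \<open>auto simp: xs ys_eq successively_append_iff successively_Cons
            hd_append split: if_splits\<close>)
      moreover have "walk_weight w xs =
          walk_weight w (z # bs @ [z]) * walk_weight w ((a # as) @ z # cs)"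
        using walk_weight_join[of w "a # as" z "bs @ z # cs"] walk_weight_join[of w "z # bs" z cs]
          walk_weight_join[of w "a # as" z cs]
        by (simp add: xs ys_eq)
      ultimately show ?thesis by simp
    next
      case dist: True
      obtain b zs where ys_eq: "ys = b # zs" using ys by (cases ys) auto
      have ab: "{a, b} \<in> edges G" using walk ys_eq by simp
      then have "zs \<noteq> []" using last loopless ys_eq by auto
      then obtain c us where zs: "zs = c # us" by (cases zs) auto
      show ?thesis
      proof (cases us)
        case Nil
        \<comment> \<open>Here \<open>c = a\<close>: one edge is traversed forth and back.\<close>
        have "walk_weight w xs = w {a, b} * w {a, b}"
          using last by (simp add: xs ys_eq zs Nil insert_commute)
        then show ?thesis using nonzero[OF ab]
          by (metis not_square_less_zero mult_eq_0_iff linorder_less_linear)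
      next
        case (Cons d rest)
        show ?thesis
        proof (cases "rest = []")
          case True
          then show ?thesis using triangle[of a b c] walk last by (simp add: xs ys_eq zs Cons)
        next
          case False
          then have a: "a \<in> set rest" "last rest = a"
            using last by (auto simp: ys_eq zs Cons)
          \<comment> \<open>\<open>ys\<close> is a cycle of length at least four, closed by the edge
            from \<open>a\<close> to \<open>b\<close>. Since \<open>a\<close> lies in
            \<open>rest\<close>, it differs from \<open>c\<close>, so the two neighbours of
            \<open>b\<close> are joined by a chord.\<close>
          have "{a, c} \<in> edges G"
            by (rule chord[of ys]) (use walk dist last a ab in \<open>auto simp: ys_eq zs Cons\<close>)
          then have ac: "{a, c} \<in> edges G" "{c, a} \<in> edges G" by (simp_all add: insert_commute)
          have "walk_weight w (a # c # d # rest) > 0"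
            by (rule IH) (use walk ac last in \<open>auto simp: xs ys_eq zs Cons\<close>)
          moreover have "walk_weight w [a, b, c, a] > 0"
            by (rule triangle) (use walk ac in \<open>auto simp: ys_eq zs Cons\<close>)
          ultimately have "walk_weight w (a # c # d # rest) * walk_weight w [a, b, c, a] > 0"
            by (rule mult_pos_pos)
          \<comment> \<open>Both the shortcut walk and the triangle use the chord once, so it
            contributes a positive square that can be cancelled.\<close>
          moreover have "walk_weight w (a # c # d # rest) * walk_weight w [a, b, c, a] =
              (w {a, c})\<^sup>2 * walk_weight w xs"
            by (simp add: xs ys_eq zs Cons power2_eq_square insert_commute mult_ac)
          ultimately show ?thesis
            using zero_less_mult_pos nonzero[OF ac(1)] by (metis zero_less_power2)
        qed
      qed
    qed
  qed
qed

section \<open>Switching\<close>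

text \<open>Each component gets a root, and \<open>s v\<close> is the sign of a chosen walk from the
  root to \<open>v\<close>. Positivity of closed walks makes these signs agree with every
  edge.\<close>

lemma ex_switching:
  fixes w :: "'v set \<Rightarrow> real"
  assumes nonzero: "\<And>e. e \<in> edges G \<Longrightarrow> w e \<noteq> 0"
    and pos: "\<And>xs. walk G xs \<Longrightarrow> xs \<noteq> [] \<Longrightarrow> hd xs = last xs \<Longrightarrow> walk_weight w xs > 0"
  obtains s :: "'v \<Rightarrow> real"
  where "\<And>v. \<bar>s v\<bar> = 1" "\<And>u v. {u, v} \<in> edges G \<Longrightarrow> w {u, v} = s u * \<bar>w {u, v}\<bar> * s v"
proof -
  define root where "root v = (SOME r. reachable G r v)" for v
  have root: "reachable G (root v) v" for v
    unfolding root_def by (rule someI) (rule reachable_refl)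
  have "\<forall>v. \<exists>xs. xs \<noteq> [] \<and> hd xs = root v \<and> last xs = v \<and> walk G xs"
    using root reachable_imp_walk by metis
  then obtain p where p: "\<And>v. p v \<noteq> []" "\<And>v. hd (p v) = root v" "\<And>v. last (p v) = v"
      "\<And>v. walk G (p v)"
    by metis
  define s where "s v = sgn (walk_weight w (p v))" for v
  have "\<bar>s v\<bar> = 1" for v
    using walk_weight_nonzero[OF p(4) nonzero] by (simp add: s_def abs_sgn_eq)
  moreover have "w {u, v} = s u * \<bar>w {u, v}\<bar> * s v" if uv: "{u, v} \<in> edges G" for u v
  proof -
    have "reachable G r u \<longleftrightarrow> reachable G r v" for r
      using reachable_edge[OF uv] reachable_sym reachable_trans by metis
    \<comment> \<open>The ends of an edge are reachable from the same vertices, so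
      \<open>SOME\<close> is applied to equal predicates.\<close>
    then have "root u = root v" by (simp add: root_def)
    \<comment> \<open>From the root to \<open>u\<close>, across the edge to \<open>v\<close>, and
      back to the root: a closed walk.\<close>
    then have "walk_weight w (p u @ rev (p v)) > 0"
      using p uv by (intro pos) (auto simp: successively_append_iff walk_rev hd_rev last_rev
          simp del: successively_rev)
    then have "walk_weight w (p u) * w {u, v} * walk_weight w (p v) > 0"
      using p by (simp add: walk_weight_append walk_weight_rev hd_rev)
    then have "s u * sgn (w {u, v}) * s v = 1"
      unfolding s_def by (metis sgn_mult sgn_pos)
    moreover have "s u * s u = 1" "s v * s v = 1"
      using \<open>\<And>v. \<bar>s v\<bar> = 1\<close> by (metis abs_mult_self_eq mult_1)+
    ultimately have "sgn (w {u, v}) = s u * s v"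
      by (metis mult.assoc mult.commute mult_1)
    then show ?thesis
      by (metis mult.assoc mult.commute sgn_mult_abs)
  qed
  ultimately show thesis using that by blast
qed

text \<open>\<open>A\<close> arises from \<open>B\<close> by conjugation with a diagonal matrix of
  signs. In the Leibniz formula each term gains the product of all \<open>s i\<close> and that of
  all \<open>s (p i)\<close>; reindexing by \<open>p\<close> makes them equal, and their product is
  1.\<close>

lemma det_switching:
  fixes s :: "'n::finite \<Rightarrow> real" and A B :: "real^'n^'n"
  assumes s: "\<And>i. \<bar>s i\<bar> = 1" and A: "\<And>i j. A $ i $ j = s i * B $ i $ j * s j"
  shows "det A = det B"
proof -
  have sq: "prod s UNIV * prod s UNIV = 1"
  proof -
    have "s i * s i = 1" for i using s by (metis abs_mult_self_eq mult_1)
    then show ?thesis by (simp flip: prod.distrib)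
  qed
  have "(\<Prod>i\<in>UNIV. A $ i $ p i) = (\<Prod>i\<in>UNIV. B $ i $ p i)" if "p permutes UNIV" for p
  proof -
    have "(\<Prod>i\<in>UNIV. s (p i)) = prod s UNIV"
      using prod.permute[OF that, of s] by (simp add: o_def)
    then show ?thesis using sq by (simp add: A prod.distrib mult_ac)
  qed
  then show ?thesis by (simp add: det_def)
qed

theorem theorem2:
  fixes G :: "'v::finite weighted_graph"
  assumes "weighted_signed_graph G"
    and "verts G = UNIV"
    and "block_graph G"
    and "\<And>vs. is_cycle G vs \<Longrightarrow> length vs = 3 \<Longrightarrow> balanced_cycle G vs"
  shows "det (adjacency_matrix G) = det (adjacency_matrix (abs_graph G))"
proof -
  have simple: "simple_graph G" and nonzero: "\<And>e. e \<in> edges G \<Longrightarrow> weight G e \<noteq> 0"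
    using assms(1) by (auto simp: weighted_signed_graph_def)
  have loopless: "{u, u} \<notin> edges G" for u
    using simple by (auto simp: simple_graph_def)
  \<comment> \<open>Cycles list each vertex once, while a closed walk repeats its start at the end.
    The absence of loops makes the three vertices distinct.\<close>
  have triangle: "walk_weight (weight G) [a, b, c, a] > 0" if "walk G [a, b, c, a]" for a b c
  proof -
    have edges: "{a, b} \<in> edges G" "{b, c} \<in> edges G" "{c, a} \<in> edges G" using that by simp_all
    then have "a \<noteq> b" "b \<noteq> c" "c \<noteq> a" using loopless by metis+
    then have "is_cycle G [a, b, c]"
      using edges by (simp add: is_cycle_def assms(2) cycle_edge_def All_less_Suc)
    from assms(4)[OF this] show ?thesis
      by (simp add: balanced_cycle_def cycle_edge_def lessThan_Suc mult_ac)
  qed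
  have chord: "{u, v} \<in> edges G"
    if "walk G vs" "distinct vs" "{last vs, hd vs} \<in> edges G" "u \<in> set vs" "v \<in> set vs" "u \<noteq> v"
    for vs u v
    by (rule block_graph_cycle_clique) (use assms simple that in auto)
  have pos: "walk_weight (weight G) xs > 0" if "walk G xs" "xs \<noteq> []" "hd xs = last xs" for xs
    by (rule closed_walk_weight_pos[OF loopless nonzero triangle chord that])
  obtain s :: "'v \<Rightarrow> real" where s: "\<And>v. \<bar>s v\<bar> = 1"
      "\<And>u v. {u, v} \<in> edges G \<Longrightarrow> weight G {u, v} = s u * \<bar>weight G {u, v}\<bar> * s v"
    using ex_switching[of G "weight G", OF nonzero pos] by metis
  \<comment> \<open>Where there is no edge, both entries are zero.\<close>
  have "adjacency_matrix G $ i $ j = s i * adjacency_matrix (abs_graph G) $ i $ j * s j" for i j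
    using s(2) by (simp add: adjacency_matrix_def abs_graph_def)
  with s(1) show ?thesis by (rule det_switching)
qed

end
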